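(* For all real $\sigma\le 0$ and $t\ge 16\pi$, $$|\mathcal{R}(\sigma+it)|\le \frac{19\,t}{(2\pi)^{1-\sigma}}\bigl\{(1-\sigma)^2+t^2\bigr\}^{\frac14-\frac{\sigma}{2}}.$$
   Context: $\mathcal{R}(s)$ is Riemann's auxiliary function, the entire function defined for all $s\in\mathbf{C}$ by $$\mathcal{R}(s)=\int_{L}\frac{x^{-s}e^{\pi i x^2}}{e^{\pi i x}-e^{-\pi i x}}\,dx,$$ where $L$ is the straight line through a point $c$ of the real interval $(0,1)$ (the value does not depend on $c$) parallel to the bisector of the first quadrant, i.e. $\{c+ue^{\pi i/4}:u\in\mathbf{R}\}$, traversed from upper right to lower left ($u$ decreasing from $+\infty$ to $-\infty$), and $x^{-s}=\exp(-s\log x)$ with the principal branch of $\log$. *)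

theory Defs
  imports "HOL-Analysis.Analysis"
begin

definition aux_line :: "real \<Rightarrow> real \<Rightarrow> complex" where
  "aux_line c u = complex_of_real c + complex_of_real u * exp (\<i> * pi / 4)"

text \<open>Since \<^term>\<open>Ln\<close> is the principal logarithm and
  \<^term>\<open>x powr (- s) = exp (- s * Ln x)\<close> for \<^term>\<open>x \<noteq> (0::complex)\<close>, the power below is the
  principal one.  For \<open>0 < c < 1\<close> the line meets the real axis only in \<open>c\<close>, so it avoids
  both the branch cut and the poles at the integers.\<close>

definition aux_integrand :: "complex \<Rightarrow> complex \<Rightarrow> complex" where
  "aux_integrand s x =
     x powr (- s) * exp (pi * \<i> * x\<^sup>2) / (exp (pi * \<i> * x) - exp (- (pi * \<i> * x)))"

text \<open>Riemann's auxiliary function, computed on the line through \<open>c\<close>.  The line is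
  traversed with \<open>u\<close> decreasing from infinity to minus infinity, hence the minus sign;
  the factor \<open>exp (\<i> * pi / 4)\<close> is the derivative of \<^term>\<open>aux_line c\<close>.\<close>

definition riemann_aux :: "real \<Rightarrow> complex \<Rightarrow> complex" where
  "riemann_aux c s =
     - (LINT u|lborel. aux_integrand s (aux_line c u) * exp (\<i> * pi / 4))"

end

theory Submission
  imports Defs "HOL-Complex_Analysis.Cauchy_Integral_Theorem" "HOL-Real_Asymp.Real_Asymp"
begin

text \<open>The line of integration is rotated into the line through \<open>1/2\<close> of slope \<open>1 / t\<close>. The two lines
  cross in a point \<open>d\<close> and bound two opposite convex cones with apex \<open>d\<close> which contain neither
  an integer nor a point of the branch cut; the integrand has a primitive on each cone and
  decays like a Gaussian at infinity, so that the integral is unchanged and no residues occur.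
  Write \<open>k = - \<sigma>\<close>.  On the shallow line the argument of \<open>x\<close> is at most \<open>1 / t\<close>, hence
  \<open>exp (t * Arg x) \<le> exp 1\<close>; the factor \<open>\<bar>x\<bar> powr k * exp (- 2 * pi * Re x * Im x)\<close> is at most a constant
  times \<open>(\<bar>1 - s\<bar> / (2 * pi)) powr k\<close>; and the reciprocal of the denominator, being small
  like \<open>1 / sinh (pi * u / t)\<close>, has an integral of order \<open>t powr (3/2)\<close>.\<close>

section \<open>Integrals along two crossing lines\<close>

text \<open>A function differentiable on the convex cone has a primitive \<open>g\<close> there. The
  terms \<open>g d\<close> cancel, leaving the increment of \<open>g\<close> along the chord from
  \<open>d + R * a\<close> to \<open>d + R * b\<close>. This chord has length
  \<open>R * cmod (a - b)\<close>, and the integrand is at most \<open>B R\<close> on it.\<close>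

lemma cone_integral_tendsto:
  fixes f :: "complex \<Rightarrow> complex"
  assumes fd: "\<And>p q. p \<ge> 0 \<Longrightarrow> q \<ge> 0 \<Longrightarrow>
      f field_differentiable at (d + of_real p * a + of_real q * b)"
    and bd: "\<forall>\<^sub>F R in at_top. \<forall>v\<in>{0..1}.
      cmod (f (d + of_real R * ((1 - of_real v) * a + of_real v * b))) \<le> B R"
    and lim: "((\<lambda>R. R * B R) \<longlongrightarrow> 0) at_top"
  shows "((\<lambda>R. integral {0..R} (\<lambda>u. f (d + of_real u * a) * a)
               - integral {0..R} (\<lambda>u. f (d + of_real u * b) * b)) \<longlongrightarrow> 0) at_top"
proof -
  define S where "S = {d + of_real p * a + of_real q * b |p q. p \<ge> 0 \<and> q \<ge> (0::real)}"
  have SI: "d + of_real p * a + of_real q * b \<in> S" if "p \<ge> 0" "q \<ge> 0" for p q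
    using that unfolding S_def by blast
  have "convex S"
  proof (rule convexI)
    fix x y and u v :: real
    assume "x \<in> S" "y \<in> S" and uv: "0 \<le> u" "0 \<le> v" "u + v = 1"
    then obtain p q p' q' where x: "x = d + of_real p * a + of_real q * b"
      and y: "y = d + of_real p' * a + of_real q' * b"
      and pos: "p \<ge> 0" "q \<ge> 0" "p' \<ge> 0" "q' \<ge> 0"
      unfolding S_def by blast
    have "u *\<^sub>R x + v *\<^sub>R y = of_real (u + v) * d + of_real (u * p + v * p') * a + of_real (u * q + v * q') * b"
      by (simp add: x y scaleR_conv_of_real algebra_simps)
    also have "\<dots> \<in> S"
      using SI[of "u * p + v * p'" "u * q + v * q'"] uv pos by simp
    finally show "u *\<^sub>R x + v *\<^sub>R y \<in> S" .
  qed
  have fdS: "f field_differentiable at x" if "x \<in> S" for x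
    using that fd unfolding S_def by blast
  \<comment> \<open>The cone contains its boundary rays, so \<open>g\<close> is differentiated only
    within \<open>S\<close>; this is enough, as both rays and the chord stay in
    \<open>S\<close>.\<close>
  obtain g where g: "\<And>x. x \<in> S \<Longrightarrow> (g has_field_derivative f x) (at x within S)"
  proof (rule holomorphic_convex_primitive[OF \<open>convex S\<close>, of "{}" f])
    show "continuous_on S f"
      by (meson continuous_at_imp_continuous_on fdS field_differentiable_imp_continuous_at)
    show "f field_differentiable at x" if "x \<in> interior S - {}" for x
      using that fdS interior_subset by blast
  qed auto
  have ftc: "integral {0..R} (\<lambda>u. f (d + of_real u * w) * w) = g (d + of_real R * w) - g d"
    if R: "R \<ge> 0" and w: "\<And>u. u \<ge> 0 \<Longrightarrow> d + of_real u * w \<in> S" for R w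
  proof (rule integral_unique)
    have "((\<lambda>u. f (d + of_real u * w) * w) has_integral
        (g (d + of_real R * w) - g (d + of_real 0 * w))) {0..R}"
    proof (rule fundamental_theorem_of_calculus[OF R])
      fix u assume u: "u \<in> {0..R}"
      have "((\<lambda>u. d + of_real u * w) has_vector_derivative w) (at u within {0..R})"
        by (auto intro!: derivative_eq_intros simp: has_vector_derivative_complex_iff)
      moreover have "(g has_field_derivative f (d + of_real u * w))
          (at (d + of_real u * w) within (\<lambda>u. d + of_real u * w) ` {0..R})"
        by (rule has_field_derivative_subset[OF g[OF w]]) (use u w in auto)
      ultimately have "(g \<circ> (\<lambda>u. d + of_real u * w) has_vector_derivative w * f (d + of_real u * w))
          (at u within {0..R})"
        by (rule field_vector_diff_chain_within)
      then show "((\<lambda>u. g (d + of_real u * w)) has_vector_derivative f (d + of_real u * w) * w)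
          (at u within {0..R})"
        by (simp add: o_def mult.commute)
    qed
    then show "((\<lambda>u. f (d + of_real u * w) * w) has_integral
        (g (d + of_real R * w) - g d)) {0..R}" by simp
  qed
  have ua: "d + of_real u * a \<in> S" and ub: "d + of_real u * b \<in> S" if "u \<ge> 0" for u
    using SI[of u 0] SI[of 0 u] that by simp_all
  have "\<forall>\<^sub>F R in at_top. cmod (integral {0..R} (\<lambda>u. f (d + of_real u * a) * a)
               - integral {0..R} (\<lambda>u. f (d + of_real u * b) * b)) \<le> cmod (a - b) * (R * B R)"
    using bd eventually_ge_at_top[of 0]
  proof eventually_elim
    case (elim R)
    have seg: "d + of_real R * ((1 - of_real v) * a + of_real v * b) \<in> S" if "v \<in> {0..1}" for v
    proof -
      have eq: "d + of_real R * ((1 - of_real v) * a + of_real v * b)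
          = d + of_real (R * (1 - v)) * a + of_real (R * v) * b"
        by (simp add: algebra_simps)
      show ?thesis
        unfolding eq by (rule SI) (use that elim in auto)
    qed
    define T where "T = closed_segment (d + of_real R * a) (d + of_real R * b)"
    have T: "\<exists>v\<in>{0..1}. z = d + of_real R * ((1 - of_real v) * a + of_real v * b)" if "z \<in> T" for z
      using that unfolding T_def closed_segment_def
      by (auto simp: scaleR_conv_of_real algebra_simps)
    have "cmod (g (d + of_real R * a) - g (d + of_real R * b))
        \<le> B R * cmod ((d + of_real R * a) - (d + of_real R * b))"
    proof (rule field_differentiable_bound)
      show "convex T" by (simp add: T_def)
      show "(g has_field_derivative f z) (at z within T)" if "z \<in> T" for z
        by (rule has_field_derivative_subset[OF g]) (use that T seg in blast)+
      show "cmod (f z) \<le> B R" if "z \<in> T" for z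
        using T[OF that] elim by blast
    qed (auto simp: T_def)
    also have "(d + of_real R * a) - (d + of_real R * b) = of_real R * (a - b)"
      by (simp add: algebra_simps)
    also have "g (d + of_real R * a) - g (d + of_real R * b)
        = integral {0..R} (\<lambda>u. f (d + of_real u * a) * a)
               - integral {0..R} (\<lambda>u. f (d + of_real u * b) * b)"
      by (subst (1 2) ftc) (use elim(2) ua ub in auto)
    finally show ?case
      using elim(2) by (simp only: norm_mult norm_of_real) (simp add: mult_ac)
  qed
  moreover have "((\<lambda>R. cmod (a - b) * (R * B R)) \<longlongrightarrow> 0) at_top"
    using tendsto_mult_right_zero[OF lim] by simp
  ultimately show ?thesis
    by (rule Lim_null_comparison)
qed

text \<open>This links the Lebesgue integral over the whole line to the truncated integrals to which
  the fundamental theorem applies, with both halves running outwards from 0.\<close>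

lemma integral_symmetric_tendsto:
  fixes g :: "real \<Rightarrow> complex"
  assumes g: "integrable lborel g"
  shows "((\<lambda>R. integral {0..R} g + integral {0..R} (\<lambda>u. g (- u)))
     \<longlongrightarrow> (LINT u|lborel. g u)) at_top"
proof -
  have g': "integrable lborel (\<lambda>u. g (- u))"
    using lborel_integrable_real_affine[OF g, of "-1" 0] by simp
  have si: "set_integrable lborel {0..} h" if "integrable lborel h" for h :: "real \<Rightarrow> complex"
    using that integrable_mult_indicator[of "{0..}" lborel h] by (simp add: set_integrable_def)
  have lim: "((\<lambda>R. integral {0..R} h) \<longlongrightarrow> (LINT u:{0..}|lborel. h u)) at_top"
    if h: "integrable lborel h" for h :: "real \<Rightarrow> complex"
  proof -
    have "(LINT u:{0..R}|lborel. h u) = integral {0..R} h" for R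
      by (rule set_borel_integral_eq_integral)
        (use h integrable_mult_indicator[of "{0..R}" lborel h] in \<open>simp add: set_integrable_def\<close>)
    then show ?thesis
      using tendsto_set_lebesgue_integral_at_top[of 0 lborel h, OF _ si[OF h]] by simp
  qed
  have "(LINT u|lborel. g u) = (LINT u:{0..}|lborel. g u) + (LINT u:{..<0}|lborel. g u)"
  proof -
    have "(LINT u:{0..} \<union> {..<0}|lborel. g u) = (LINT u:{0..}|lborel. g u) + (LINT u:{..<0}|lborel. g u)"
      by (rule set_integral_Un)
        (use g integrable_mult_indicator[of "{..<0}" lborel g] si[OF g] in \<open>auto simp: set_integrable_def\<close>)
    moreover have "{0..} \<union> {..<0} = (UNIV :: real set)" by auto
    ultimately show ?thesis by (simp add: set_lebesgue_integral_def)
  qed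
  also have "(LINT u:{..<0}|lborel. g u) = (LINT u|lborel. indicat_real {..<0} (- u) *\<^sub>R g (- u))"
    using lborel_integral_real_affine[of "-1" "\<lambda>u. indicat_real {..<0} u *\<^sub>R g u" 0]
    by (simp add: set_lebesgue_integral_def)
  \<comment> \<open>Reflection turns the open negative half-line into the open positive one, which
    differs from \<open>{0..}\<close> only in the null set of the point 0.\<close>
  also have "\<dots> = (LINT u:{0..}|lborel. g (- u))"
    unfolding set_lebesgue_integral_def
  proof (rule integral_cong_AE)
    have m[measurable]: "(\<lambda>u. g (- u)) \<in> borel_measurable lborel"
      using g' by (rule borel_measurable_integrable)
    have i: "(\<lambda>u::real. indicat_real {..<0} (- u)) = indicat_real {0<..}"
      by (auto simp: indicator_def fun_eq_iff)
    show "(\<lambda>u. indicat_real {..<0} (- u) *\<^sub>R g (- u)) \<in> borel_measurable lborel"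
      unfolding i by measurable
    show "(\<lambda>u. indicat_real {0..} u *\<^sub>R g (- u)) \<in> borel_measurable lborel"
      by measurable
    show "AE u in lborel. indicat_real {..<0} (- u) *\<^sub>R g (- u) = indicat_real {0..} u *\<^sub>R g (- u)"
      using AE_lborel_singleton[of 0]
      by eventually_elim (auto simp: indicator_def)
  qed
  finally show ?thesis
    using tendsto_add[OF lim[OF g] lim[OF g']] by simp
qed

text \<open>Each line splits at \<open>d\<close> into two rays, and the cone estimate is applied to
  the directions \<open>a\<close>, \<open>b\<close> and to \<open>- a\<close>, \<open>- b\<close>.
  Running outwards along \<open>- w\<close> reverses the orientation of the line, so the second
  limit is subtracted from the first.\<close>

lemma crossing_lines_integral_eq:
  fixes f :: "complex \<Rightarrow> complex"
  assumes fd: "\<And>p q. p \<ge> 0 \<and> q \<ge> 0 \<or> p \<le> 0 \<and> q \<le> 0 \<Longrightarrow>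
      f field_differentiable at (d + of_real p * a + of_real q * b)"
    and bd: "\<And>\<delta>. \<delta> \<in> {1, -1} \<Longrightarrow> \<forall>\<^sub>F R in at_top. \<forall>v\<in>{0..1}.
      cmod (f (d + of_real R * ((1 - of_real v) * (\<delta> * a) + of_real v * (\<delta> * b)))) \<le> B R"
    and lim: "((\<lambda>R. R * B R) \<longlongrightarrow> 0) at_top"
    and int: "integrable lborel (\<lambda>u. f (d + of_real u * a) * a)"
      "integrable lborel (\<lambda>u. f (d + of_real u * b) * b)"
  shows "(LINT u|lborel. f (d + of_real u * a) * a) = (LINT u|lborel. f (d + of_real u * b) * b)"
proof -
  let ?I = "\<lambda>w R. integral {0..R} (\<lambda>u. f (d + of_real u * w) * w)"
  have 1: "((\<lambda>R. ?I a R - ?I b R) \<longlongrightarrow> 0) at_top"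
    by (rule cone_integral_tendsto[OF fd _ lim]) (use bd[of 1] in auto)
  have 2: "((\<lambda>R. ?I (- a) R - ?I (- b) R) \<longlongrightarrow> 0) at_top"
  proof (rule cone_integral_tendsto[OF _ _ lim])
    show "f field_differentiable at (d + of_real p * (- a) + of_real q * (- b))"
      if "p \<ge> 0" "q \<ge> 0" for p q
      using fd[of "- p" "- q"] that by simp
  qed (use bd[of "-1"] in auto)
  have neg: "?I (- w) R = - integral {0..R} (\<lambda>u. f (d + of_real (- u) * w) * w)" for w R
    by simp
  have "((\<lambda>R. (?I a R - ?I b R) - (?I (- a) R - ?I (- b) R)) \<longlongrightarrow> 0 - 0) at_top"
    by (rule tendsto_diff[OF 1 2])
  moreover have "((\<lambda>R. (?I a R - ?I b R) - (?I (- a) R - ?I (- b) R)) \<longlongrightarrow>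
     (LINT u|lborel. f (d + of_real u * a) * a) - (LINT u|lborel. f (d + of_real u * b) * b)) at_top"
    using tendsto_diff[OF integral_symmetric_tendsto[OF int(1)] integral_symmetric_tendsto[OF int(2)]]
    by (rule Lim_transform_eventually) (auto simp: neg intro!: always_eventually)
  ultimately show ?thesis
    using tendsto_unique[of at_top] trivial_limit_at_top_linorder by fastforce
qed

section \<open>Modulus, differentiability and decay of the integrand\<close>

text \<open>With \<open>s = Complex \<sigma> t\<close>, the real part of \<open>- s * Ln x\<close>
  is \<open>- \<sigma> * ln (cmod x) + t * Im (Ln x)\<close>, and that of
  \<open>pi * \<i> * x\<^sup>2\<close> is \<open>- 2 * pi * Re x * Im x\<close>.\<close>

lemma cmod_aux_integrand:
  assumes "x \<noteq> 0"
  shows "cmod (aux_integrand (Complex \<sigma> t) x) =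
    cmod x powr (- \<sigma>) * exp (t * Im (Ln x)) * exp (- 2 * pi * Re x * Im x)
      / cmod (exp (pi * \<i> * x) - exp (- (pi * \<i> * x)))"
  using assms
  by (simp add: aux_integrand_def norm_mult norm_divide powr_def power2_eq_square
      flip: exp_add)

text \<open>Reverse triangle inequality: the two exponentials have moduli
  \<open>exp (- (pi * Im x))\<close> and \<open>exp (pi * Im x)\<close>. The bound is useful away
  from the real axis.\<close>

lemma cmod_exp_diff_ge_sinh:
  "2 * sinh (pi * \<bar>Im x\<bar>) \<le> cmod (exp (pi * \<i> * x) - exp (- (pi * \<i> * x)))"
proof -
  have "2 * sinh (pi * \<bar>Im x\<bar>) = \<bar>exp (- (pi * Im x)) - exp (pi * Im x)\<bar>"
    by (cases "Im x \<ge> 0") (auto simp: sinh_def abs_if mult_less_0_iff zero_less_mult_iff not_less)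
  also have "\<dots> \<le> cmod (exp (pi * \<i> * x) - exp (- (pi * \<i> * x)))"
    using norm_triangle_ineq3[of "exp (pi * \<i> * x)" "exp (- (pi * \<i> * x))"] by simp
  finally show ?thesis .
qed

text \<open>The imaginary part of the difference is
  \<open>2 * cosh (pi * Im x) * sin (pi * Re x)\<close>, and \<open>cosh\<close> is at least 1. This
  complements the previous bound near the real axis.\<close>

lemma cmod_exp_diff_ge_sin:
  "2 * \<bar>sin (pi * Re x)\<bar> \<le> cmod (exp (pi * \<i> * x) - exp (- (pi * \<i> * x)))"
proof -
  have "2 * \<bar>sin (pi * Re x)\<bar> \<le> (exp (- (pi * Im x)) + exp (pi * Im x)) * \<bar>sin (pi * Re x)\<bar>"
  proof (rule mult_right_mono)
    have "1 \<le> cosh (pi * Im x)" by (rule cosh_real_ge_1)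
    then show "2 \<le> exp (- (pi * Im x)) + exp (pi * Im x)" by (simp add: cosh_def)
  qed simp
  also have "\<dots> = \<bar>Im (exp (pi * \<i> * x) - exp (- (pi * \<i> * x)))\<bar>"
  proof -
    have "Im (exp (pi * \<i> * x) - exp (- (pi * \<i> * x)))
        = (exp (- (pi * Im x)) + exp (pi * Im x)) * sin (pi * Re x)"
      by (simp add: Im_exp algebra_simps)
    then show ?thesis by (simp add: abs_mult)
  qed
  also have "\<dots> \<le> cmod (exp (pi * \<i> * x) - exp (- (pi * \<i> * x)))"
    by (rule abs_Im_le_cmod)
  finally show ?thesis .
qed

text \<open>The branch cut and the zeros of the denominator all lie on the real axis outside (0,1),
  so one condition on real points excludes both.\<close>

lemma aux_integrand_field_differentiable:
  assumes "Im x = 0 \<Longrightarrow> 0 < Re x \<and> Re x < 1"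
  shows "aux_integrand s field_differentiable at x"
proof -
  have "exp (pi * \<i> * x) - exp (- (pi * \<i> * x)) \<noteq> 0"
  proof (cases "Im x = 0")
    case True
    with assms have "sin (pi * Re x) > 0"
      by (intro sin_gt_zero) auto
    with cmod_exp_diff_ge_sin[of x] show ?thesis by auto
  next
    case False
    then have "sinh (pi * \<bar>Im x\<bar>) > 0" by simp
    with cmod_exp_diff_ge_sinh[of x] show ?thesis by force
  qed
  moreover have "x \<notin> \<real>\<^sub>\<le>\<^sub>0" "x \<noteq> 0"
    using assms by (auto simp: complex_nonpos_Reals_iff)
  ultimately show ?thesis
    unfolding aux_integrand_def[abs_def] field_differentiable_def
    by (auto intro!: derivative_eq_intros exI)
qed

lemma le_sinh:
  fixes z :: real
  assumes "z \<ge> 0"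
  shows "z \<le> sinh z"
  using real_le_x_sinh[OF assms] by (simp add: sinh_def exp_minus)

text \<open>The exponent 3/2 exceeds 1, so the reciprocal is integrable at infinity, and scaling by
  \<open>t\<close> yields exactly the order \<open>t powr (3/2)\<close> wanted in the end. The proof
  compares \<open>sqrt z \<le> (1 + z) / 2 \<le> 1 + z\<^sup>2 / 8\<close>, the last by
  \<open>(z - 2)\<^sup>2 \<ge> 0\<close>, with the doubling formula for \<open>sinh\<close>.\<close>

lemma powr_three_halves_le_sinh:
  fixes z :: real
  assumes "z \<ge> 0"
  shows "z powr (3/2) \<le> sinh z"
proof -
  have cosh: "1 + z\<^sup>2 / 8 \<le> cosh (z / 2)"
  proof -
    have "cosh (z / 2) = (cosh (z / 4))\<^sup>2 + (sinh (z / 4))\<^sup>2"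
      using cosh_double[of "z / 4"] by simp
    also have "\<dots> = 1 + 2 * (sinh (z / 4))\<^sup>2"
      by (simp add: cosh_square_eq)
    finally show ?thesis
      using power_mono[OF le_sinh[of "z / 4"], of 2] assms by (simp add: power_divide)
  qed
  have "z powr (3/2) = z * sqrt z"
    using assms powr_add[of z 1 "1/2"] by (cases "z = 0") (simp_all add: powr_half_sqrt)
  also have "sqrt z \<le> 1 + z\<^sup>2 / 8"
  proof -
    have "sqrt z \<le> (1 + z) / 2"
      using arith_geo_mean_sqrt[of 1 z] assms by simp
    moreover have "(1 + z) / 2 \<le> 1 + z\<^sup>2 / 8"
      using zero_le_power2[of "z - 2"] by (simp add: power2_eq_square algebra_simps)
    ultimately show ?thesis by linarith
  qed
  also have "z * (1 + z\<^sup>2 / 8) \<le> (2 * sinh (z / 2)) * cosh (z / 2)"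
    using cosh le_sinh[of "z / 2"] assms by (intro mult_mono) auto
  also have "\<dots> = sinh z"
    using sinh_double[of "z / 2"] by simp
  finally show ?thesis
    using assms by (simp add: mult_left_mono)
qed

text \<open>Far out in either cone, \<open>Re x\<close> and \<open>Im x\<close> have the same sign
  and modulus at least \<open>m * R / 2\<close>. Hence \<open>exp (- 2 * pi * Re x * Im x)\<close>
  is Gaussian in \<open>R\<close>, which beats the power of \<open>cmod x\<close>; the argument
  contributes at most \<open>exp (\<bar>t\<bar> * pi)\<close>.\<close>

lemma aux_integrand_decay:
  fixes d a b :: complex and \<sigma> t m :: real
  assumes "\<sigma> \<le> 0" and m: "0 < m" "m \<le> Re a" "m \<le> Im a" "m \<le> Re b" "m \<le> Im b"
  obtains B where "\<And>\<delta>. \<delta> \<in> {1, -1} \<Longrightarrow> \<forall>\<^sub>F R in at_top. \<forall>v\<in>{0..1}.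
      cmod (aux_integrand (Complex \<sigma> t)
        (d + of_real R * ((1 - of_real v) * (\<delta> * a) + of_real v * (\<delta> * b)))) \<le> B R"
    and "((\<lambda>R. R * B R) \<longlongrightarrow> 0) at_top"
proof -
  define C where "C = cmod a + cmod b + 1"
  have "C > 0" by (simp add: C_def add_nonneg_pos)
  define B where "B = (\<lambda>R. (C * R) powr (- \<sigma>) * exp (\<bar>t\<bar> * pi) * exp (- 2 * pi * (m * R / 2)\<^sup>2))"
  show ?thesis
  proof
    show "((\<lambda>R. R * B R) \<longlongrightarrow> 0) at_top"
      unfolding B_def using \<open>C > 0\<close> \<open>m > 0\<close> by real_asymp
  next
    fix \<delta> :: complex assume \<delta>: "\<delta> \<in> {1, -1}"
    show "\<forall>\<^sub>F R in at_top. \<forall>v\<in>{0..1}.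
      cmod (aux_integrand (Complex \<sigma> t)
        (d + of_real R * ((1 - of_real v) * (\<delta> * a) + of_real v * (\<delta> * b)))) \<le> B R"
      \<comment> \<open>The first threshold lets the shift by \<open>d\<close> cost at most half of
        \<open>m * R\<close>, the second makes both coordinates at least 1 in modulus and so the
        denominator at least 1, and the third absorbs \<open>cmod d\<close> into the summand 1 of
        \<open>C\<close>.\<close>
      using eventually_ge_at_top[of "2 * cmod d / m"] eventually_ge_at_top[of "2 / m"]
        eventually_ge_at_top[of "cmod d"]
    proof (eventually_elim, intro ballI)
      fix R v :: real
      assume R: "2 * cmod d / m \<le> R" "2 / m \<le> R" "cmod d \<le> R" and v: "v \<in> {0..1}"
      define w where "w = (1 - of_real v) * a + of_real v * b"
      define x where "x = d + of_real R * (\<delta> * w)"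
      have mR: "cmod d \<le> m * R / 2" "1 \<le> m * R / 2"
        using R m by (auto simp: field_simps)
      have "R \<ge> 0" using R(3) norm_ge_zero order_trans by blast
      have conv: "m \<le> (1 - v) * p + v * q" if "m \<le> p" "m \<le> q" for p q
      proof -
        have "(1 - v) * m + v * m \<le> (1 - v) * p + v * q"
          using v that by (intro add_mono mult_left_mono) auto
        then show ?thesis by (simp add: algebra_simps)
      qed
      have w: "m \<le> Re w" "m \<le> Im w"
        using conv[of "Re a" "Re b"] conv[of "Im a" "Im b"] m by (simp_all add: w_def)
      have Rw: "m * R \<le> R * Re w" "m * R \<le> R * Im w"
        using w \<open>R \<ge> 0\<close> by (auto simp: mult.commute[of m] intro!: mult_left_mono)
      have d: "\<bar>Re d\<bar> \<le> m * R / 2" "\<bar>Im d\<bar> \<le> m * R / 2"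
        using mR abs_Re_le_cmod[of d] abs_Im_le_cmod[of d] by linarith+
      have x: "\<delta> = 1 \<and> m * R / 2 \<le> Re x \<and> m * R / 2 \<le> Im x
             \<or> \<delta> = -1 \<and> m * R / 2 \<le> - Re x \<and> m * R / 2 \<le> - Im x"
        using \<delta> Rw d by (auto simp: x_def)
      have prod: "(m * R / 2)\<^sup>2 \<le> Re x * Im x"
      proof -
        have "(m * R / 2) * (m * R / 2) \<le> \<bar>Re x\<bar> * \<bar>Im x\<bar>"
          using x mR by (intro mult_mono) auto
        also have "\<dots> = Re x * Im x"
          using x mR by (auto simp: abs_if)
        finally show ?thesis by (simp add: power2_eq_square)
      qed
      have "x \<noteq> 0" using x mR by auto
      have "cmod w \<le> \<bar>1 - v\<bar> * cmod a + \<bar>v\<bar> * cmod b"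
        unfolding w_def by (metis (no_types) norm_triangle_ineq norm_mult norm_of_real of_real_1 of_real_diff)
      also have "\<dots> \<le> 1 * cmod a + 1 * cmod b"
        using v by (intro add_mono mult_right_mono) auto
      finally have "R * cmod w \<le> R * (cmod a + cmod b)"
        using \<open>R \<ge> 0\<close> by (simp add: mult_left_mono)
      moreover have "cmod x \<le> cmod d + R * cmod w"
        using norm_triangle_ineq[of d "of_real R * (\<delta> * w)"] \<delta> \<open>R \<ge> 0\<close>
        by (auto simp: x_def norm_mult)
      ultimately have cx: "cmod x \<le> C * R"
        using R(3) by (simp add: C_def algebra_simps)
      have "1 \<le> 2 * sinh (pi * \<bar>Im x\<bar>)"
      proof -
        have "1 * 1 \<le> pi * \<bar>Im x\<bar>"
          using x mR pi_ge_two by (intro mult_mono) auto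
        then show ?thesis
          using le_sinh[of "pi * \<bar>Im x\<bar>"] by linarith
      qed
      then have den: "1 \<le> cmod (exp (pi * \<i> * x) - exp (- (pi * \<i> * x)))"
        using cmod_exp_diff_ge_sinh[of x] by linarith
      have arg: "t * Im (Ln x) \<le> \<bar>t\<bar> * pi"
      proof -
        have "t * Im (Ln x) \<le> \<bar>t * Im (Ln x)\<bar>" by simp
        also have "\<dots> \<le> \<bar>t\<bar> * pi"
          unfolding abs_mult
          by (intro mult_left_mono) (use mpi_less_Im_Ln[OF \<open>x \<noteq> 0\<close>] Im_Ln_le_pi[OF \<open>x \<noteq> 0\<close>] in auto)
        finally show ?thesis .
      qed
      have "cmod (aux_integrand (Complex \<sigma> t) x) \<le>
         cmod x powr (- \<sigma>) * exp (t * Im (Ln x)) * exp (- 2 * pi * Re x * Im x) / 1"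
        unfolding cmod_aux_integrand[OF \<open>x \<noteq> 0\<close>]
        using den by (intro divide_left_mono) auto
      also have "\<dots> \<le> B R / 1"
        unfolding B_def
        using assms(1) cx arg prod
        by (intro divide_right_mono mult_mono powr_mono2) auto
      finally show "cmod (aux_integrand (Complex \<sigma> t)
         (d + of_real R * ((1 - of_real v) * (\<delta> * a) + of_real v * (\<delta> * b)))) \<le> B R"
        by (simp add: x_def w_def algebra_simps)
    qed
  qed
qed

section \<open>An integrable majorant for the reciprocal of the denominator\<close>

lemma has_bochner_integral_powr_neg_three_halves:
  fixes a :: real
  assumes "a > 0"
  shows "has_bochner_integral lborel (\<lambda>u. u powr (- (3/2)) * indicator {a..} u) (2 / sqrt a)"
proof (rule has_bochner_integral_nn_integral)
  have "((\<lambda>u. u powr (- (3/2))) has_integral (2 / sqrt a)) {a..}"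
    using has_integral_powr_to_inf[of "- (3/2)" a] assms
    by (simp add: powr_minus powr_half_sqrt field_simps)
  then have "(\<integral>\<^sup>+ u. ennreal (u powr (- (3/2))) * indicator {a..} u \<partial>lborel) = ennreal (2 / sqrt a)"
    by (rule nn_integral_has_integral_lebesgue'[rotated]) auto
  moreover have "ennreal (u powr (- (3/2)) * indicator {a..} u)
      = ennreal (u powr (- (3/2))) * indicator {a..} u" for u :: real
    by (simp add: indicator_def)
  ultimately show "(\<integral>\<^sup>+ u. ennreal (u powr (- (3/2)) * indicator {a..} u) \<partial>lborel) = ennreal (2 / sqrt a)"
    by simp
qed (use assms in auto)

text \<open>The parameter is the horizontal offset from 1/2 rather than arc length, so the
  derivative is the constant \<open>Complex 1 (1 / t)\<close>.\<close>

definition shallow_line :: "real \<Rightarrow> real \<Rightarrow> complex" where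
  "shallow_line t u = Complex (1/2 + u) (u / t)"

text \<open>The constant piece comes from the sine bound near 1/2, the other two from the bound
  \<open>z powr (3/2) \<le> sinh z\<close> with \<open>z = pi * \<bar>u\<bar> / t\<close>. Keeping
  the tails separate reduces the integral to one half-line and its reflection.\<close>

definition tail_majorant :: "real \<Rightarrow> real \<Rightarrow> real" where
  "tail_majorant t u = indicator {-1/4..1/4} u + (t / pi) powr (3/2) / 2 *
     (u powr (- (3/2)) * indicator {1/4..} u + (- u) powr (- (3/2)) * indicator {1/4..} (- u))"

lemma has_bochner_integral_tail_majorant:
  "has_bochner_integral lborel (tail_majorant t) (1/2 + 4 * (t / pi) powr (3/2))"
proof -
  have *: "has_bochner_integral lborel (\<lambda>u::real. u powr (- (3/2)) * indicator {1/4..} u) 4"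
    using has_bochner_integral_powr_neg_three_halves[of "1/4"] by (simp add: real_sqrt_divide)
  have **: "has_bochner_integral lborel (\<lambda>u::real. (- u) powr (- (3/2)) * indicator {1/4..} (- u)) 4"
    using iffD1[OF lborel_has_bochner_integral_real_affine_iff[of "-1" _ _ 0] *] by simp
  have "has_bochner_integral lborel (indicat_real {-1/4..1/4::real}) (1/2)"
    using has_bochner_integral_real_indicator[of "{-1/4..1/4::real}" lborel]
      emeasure_bounded_finite[of "{-1/4..1/4::real}"] by simp
  from has_bochner_integral_add[OF this
      has_bochner_integral_mult_right[OF has_bochner_integral_add[OF * **], of "(t / pi) powr (3/2) / 2"]]
  show ?thesis
    unfolding tail_majorant_def[abs_def] by (simp add: algebra_simps)
qed

lemma shallow_line_ne_0: "t > 0 \<Longrightarrow> shallow_line t u \<noteq> 0"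
  by (auto simp: shallow_line_def complex_eq_iff)

lemma inverse_exp_diff_le_tail_majorant:
  assumes "t > 0"
  defines "x u \<equiv> shallow_line t u"
  shows "1 / cmod (exp (pi * \<i> * x u) - exp (- (pi * \<i> * x u))) \<le> tail_majorant t u"
proof (cases "\<bar>u\<bar> \<le> 1/4")
  case True
  have "1/2 \<le> cos \<bar>pi * u\<bar>"
  proof -
    \<comment> \<open>The angle \<open>pi / 3\<close> is chosen because \<open>cos\<close> is 1/2
      there, which makes the lower bound \<open>2 * sin (pi * Re x)\<close> equal to at least
      1.\<close>
    have "\<bar>pi * u\<bar> \<le> pi / 3"
      using True mult_left_mono[of "\<bar>u\<bar>" "1/3" pi] by (simp add: abs_mult)
    then have "cos (pi / 3) \<le> cos \<bar>pi * u\<bar>"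
      by (intro cos_monotone_0_pi_le) auto
    then show ?thesis by (simp add: cos_60)
  qed
  also have "cos \<bar>pi * u\<bar> = sin (pi * Re (x u))"
    by (simp add: x_def shallow_line_def sin_add distrib_left)
  finally have "1 \<le> cmod (exp (pi * \<i> * x u) - exp (- (pi * \<i> * x u)))"
    using cmod_exp_diff_ge_sin[of "x u"] by linarith
  then have "1 / cmod (exp (pi * \<i> * x u) - exp (- (pi * \<i> * x u))) \<le> 1"
    by (smt (verit) divide_le_eq_1)
  also have "1 \<le> tail_majorant t u"
  proof -
    have "u \<in> {-1/4..1/4}" using True by (auto simp: abs_le_iff)
    then have "indicat_real {-1/4..1/4} u = 1" by (rule indicator_simps)
    then show ?thesis by (simp add: tail_majorant_def)
  qed
  finally show ?thesis .
next
  case False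
  have "2 * (pi * \<bar>u\<bar> / t) powr (3/2) \<le> 2 * sinh (pi * \<bar>u\<bar> / t)"
    using powr_three_halves_le_sinh[of "pi * \<bar>u\<bar> / t"] assms by simp
  also have "\<dots> = 2 * sinh (pi * \<bar>Im (x u)\<bar>)"
    using assms by (simp add: x_def shallow_line_def abs_mult)
  also have "\<dots> \<le> cmod (exp (pi * \<i> * x u) - exp (- (pi * \<i> * x u)))"
    by (rule cmod_exp_diff_ge_sinh)
  finally have "1 / cmod (exp (pi * \<i> * x u) - exp (- (pi * \<i> * x u)))
      \<le> 1 / (2 * (pi * \<bar>u\<bar> / t) powr (3/2))"
    using False assms by (intro divide_left_mono mult_pos_pos) auto
  also have "\<dots> = (t / pi) powr (3/2) / 2 * \<bar>u\<bar> powr (- (3/2))"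
    using assms by (simp add: powr_divide powr_mult powr_minus field_simps)
  also have "\<dots> = tail_majorant t u"
    using False by (auto simp: tail_majorant_def indicator_def abs_if)
  finally show ?thesis .
qed

section \<open>Pointwise bound on the shallow line and its numerical constants\<close>

text \<open>For \<open>u \<ge> 0\<close> the argument is at most its tangent
  \<open>u / t / (1/2 + u)\<close>, which is at most \<open>1 / t\<close>. For \<open>u < 0\<close>
  the point lies below the real axis and its principal argument is negative, even left of the
  origin.\<close>

lemma Ln_shallow_line_le:
  assumes "t > 0"
  shows "t * Im (Ln (shallow_line t u)) \<le> 1"
proof (cases "u \<ge> 0")
  case True
  have "Im (Ln (shallow_line t u)) = arctan (u / t / (1/2 + u))"
    using arg_conv_arctan[of "shallow_line t u"] Arg_eq_Im_Ln[OF shallow_line_ne_0[OF assms]] True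
    by (simp add: shallow_line_def)
  also have "\<dots> \<le> u / t / (1/2 + u)"
    using True assms by (intro arctan_le_self) auto
  also have "\<dots> = u / (1/2 + u) / t" by simp
  also have "\<dots> \<le> 1 / t"
    using True assms by (intro divide_right_mono) auto
  finally show ?thesis
    using assms by (simp add: field_simps)
next
  case False
  then have "Im (shallow_line t u) < 0"
    using assms by (simp add: shallow_line_def divide_neg_pos)
  then have "Im (Ln (shallow_line t u)) < 0"
    using Im_Ln_pos_le[OF shallow_line_ne_0[OF assms], of u] Im_Ln_le_pi[OF shallow_line_ne_0[OF assms], of u]
    by linarith
  then show ?thesis
    using assms mult_pos_neg[of t] by (smt (verit))
qed

text \<open>This is \<open>1 + w \<le> exp w\<close> at \<open>w = y / exp 1 - 1\<close>, with
  equality at \<open>y = exp 1\<close>. It serves to trade a power of \<open>cmod x\<close> for a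
  Gaussian.\<close>

lemma le_exp_div_e: "y \<le> exp (y / exp 1)" for y :: real
proof -
  have "y / exp 1 \<le> exp (y / exp 1 - 1)"
    using exp_ge_add_one_self[of "y / exp 1 - 1"] by simp
  then show ?thesis
    by (simp add: exp_diff divide_le_cancel)
qed

text \<open>Put \<open>X = (cmod x)\<^sup>2\<close>. The previous lemma at
  \<open>y = X / M\<^sup>2\<close> bounds \<open>cmod x powr k\<close> by
  \<open>M powr k * exp (k * X / (2 * exp 1 * M\<^sup>2))\<close>. By the size of \<open>M\<close>
  this exponent is at most \<open>4 * pi * X / (3 * t)\<close>, and the decay
  \<open>- 2 * pi * u * (u + 1/2) / t\<close> cancels its growth up to the constant
  \<open>2 * pi / (3 * t)\<close>.\<close>

lemma gaussian_power_le:
  fixes k t u :: real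
  assumes k: "k \<ge> 0" and t: "t \<ge> 2"
  defines "x \<equiv> shallow_line t u" and "M \<equiv> sqrt ((1 + k)\<^sup>2 + t\<^sup>2) / (2 * pi)"
  shows "cmod x powr k * exp (- 2 * pi * Re x * Im x) \<le> M powr k * exp (2 * pi / (3 * t))"
proof -
  define X where "X = (cmod x)\<^sup>2"
  define Q where "Q = (1 + k)\<^sup>2 + t\<^sup>2"
  have Q: "2 * (k * t) \<le> Q" "Q > 0"
  proof -
    have "k\<^sup>2 \<le> (1 + k)\<^sup>2" using k by (intro power_mono) auto
    moreover have "0 \<le> (k - t)\<^sup>2" by simp
    ultimately show "2 * (k * t) \<le> Q" by (simp add: Q_def power2_diff)
    show "Q > 0" using t by (auto simp: Q_def intro: add_nonneg_pos)
  qed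
  have "M > 0" using Q by (simp add: M_def Q_def[symmetric])
  have M2: "M\<^sup>2 = Q / (4 * pi\<^sup>2)"
    using Q by (simp add: M_def Q_def[symmetric] power_divide power_mult_distrib)
  have X: "X = (1/2 + u)\<^sup>2 + (u / t)\<^sup>2"
    by (simp add: X_def x_def shallow_line_def cmod_def)
  have "X \<ge> 0" by (simp add: X_def)
  \<comment> \<open>The leading coefficient of \<open>X\<close> in \<open>u\<close> is at most 5/4,
    so the factor 3/2 leaves \<open>u\<^sup>2 / 4\<close> to complete a square.\<close>
  have Xq: "X \<le> 3/2 * (u * (u + 1/2)) + 1/2"
  proof -
    have "(u / t)\<^sup>2 \<le> u\<^sup>2 / 4"
      using t power_mono[of 2 t 2] mult_right_mono[of 4 "t\<^sup>2" "u\<^sup>2"]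
      by (simp add: power_divide field_simps)
    moreover have "0 \<le> (u / 2 - 1/4)\<^sup>2" by simp
    ultimately show ?thesis
      unfolding X by (simp add: power2_eq_square algebra_simps)
  qed
  have e: "5/2 \<le> exp (1::real)"
    using exp_lower_Taylor_quadratic[of "1::real"] by simp
  have key: "k * X / (2 * exp 1 * M\<^sup>2) \<le> 4 * pi * X / (3 * t)"
  proof -
    \<comment> \<open>The factor 4/3 in \<open>key\<close> works because
      \<open>3 * pi < 10 \<le> 4 * exp 1\<close>.\<close>
    have "3 * pi * (k * t) \<le> 4 * exp 1 * (k * t)"
      using e pi_approx k t by (intro mult_right_mono) auto
    also have "\<dots> \<le> 2 * exp 1 * Q"
      using Q(1) by simp
    finally have "k * (4 * pi\<^sup>2) * (3 * t) \<le> (4 * pi) * (2 * exp 1 * Q)"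
      by (simp add: power2_eq_square algebra_simps)
    then have "k * (4 * pi\<^sup>2) / (2 * exp 1 * Q) \<le> 4 * pi / (3 * t)"
      using Q(2) t by (simp add: divide_simps mult.commute)
    from mult_right_mono[OF this \<open>X \<ge> 0\<close>] show ?thesis
      by (simp add: M2 algebra_simps)
  qed
  have "cmod x \<le> M * exp (X / (2 * exp 1 * M\<^sup>2))"
  proof (rule power2_le_imp_le)
    have "X / M\<^sup>2 \<le> exp (X / M\<^sup>2 / exp 1)" by (rule le_exp_div_e)
    then have "X \<le> M\<^sup>2 * exp (X / M\<^sup>2 / exp 1)"
      using \<open>M > 0\<close> by (simp add: field_simps)
    also have "exp (X / M\<^sup>2 / exp 1) = (exp (X / (2 * exp 1 * M\<^sup>2)))\<^sup>2"
      by (simp add: power2_eq_square field_simps flip: exp_add)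
    finally show "(cmod x)\<^sup>2 \<le> (M * exp (X / (2 * exp 1 * M\<^sup>2)))\<^sup>2"
      by (simp add: X_def power_mult_distrib)
  qed (use \<open>M > 0\<close> in auto)
  then have "cmod x powr k \<le> (M * exp (X / (2 * exp 1 * M\<^sup>2))) powr k"
    using k by (intro powr_mono2) auto
  also have "\<dots> = M powr k * exp (k * X / (2 * exp 1 * M\<^sup>2))"
    using \<open>M > 0\<close> by (simp add: powr_mult exp_powr_real mult.commute)
  also have "\<dots> \<le> M powr k * exp (4 * pi * X / (3 * t))"
    using key by (intro mult_left_mono) auto
  finally have "cmod x powr k * exp (- 2 * pi * Re x * Im x)
      \<le> M powr k * exp (4 * pi * X / (3 * t)) * exp (- 2 * pi * Re x * Im x)"
    by (rule mult_right_mono) simp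
  also have "\<dots> = M powr k * exp (4 * pi * X / (3 * t) - 2 * pi * Re x * Im x)"
    by (simp add: mult_exp_exp)
  also have "4 * pi * X / (3 * t) - 2 * pi * Re x * Im x
      = 4 * pi / (3 * t) * (X - 3/2 * (u * (u + 1/2)))"
    using t by (simp add: x_def shallow_line_def field_simps)
  also have "M powr k * exp \<dots> \<le> M powr k * exp (4 * pi / (3 * t) * (1/2))"
    using Xq t by (intro mult_left_mono) (auto intro!: divide_right_mono)
  finally show ?thesis by simp
qed

text \<open>The argument, the Gaussian factor and the denominator are bounded separately. Since
  \<open>t \<ge> 16 * pi > 48\<close>, the constants multiply to at most
  \<open>2.72 * (1 + 1/24 + 1/576) * (1 + 1/48) < 3\<close>.\<close>

lemma cmod_aux_integrand_shallow_line_le: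
  assumes \<sigma>: "\<sigma> \<le> 0" and t: "t \<ge> 16 * pi"
  defines "M \<equiv> sqrt ((1 - \<sigma>)\<^sup>2 + t\<^sup>2) / (2 * pi)"
  shows "cmod (aux_integrand (Complex \<sigma> t) (shallow_line t u) * Complex 1 (1 / t))
    \<le> 3 * M powr (- \<sigma>) * tail_majorant t u"
proof -
  define x where "x = shallow_line t u"
  define D where "D = cmod (exp (pi * \<i> * x) - exp (- (pi * \<i> * x)))"
  have t48: "t \<ge> 48" using t pi_gt3 by linarith
  have pt: "2 * pi / (3 * t) \<le> 1/24"
    using t t48 by (simp add: field_simps)
  have tm: "0 \<le> tail_majorant t u"
    by (simp add: tail_majorant_def)
  have const: "exp (1 + 2 * pi / (3 * t)) * cmod (Complex 1 (1 / t)) \<le> 3"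
  proof -
    have "exp (2 * pi / (3 * t)) \<le> exp (1/24)" using pt by simp
    also have "\<dots> \<le> 1 + 1/24 + (1/24)\<^sup>2" by (rule exp_bound) auto
    finally have "exp 1 * exp (2 * pi / (3 * t)) \<le> (272/100) * (1 + 1/24 + (1/24)\<^sup>2)"
      using e_less_272 by (intro mult_mono) auto
    moreover have "cmod (Complex 1 (1 / t)) \<le> 1 + 1/48"
    proof -
      have "1 / t \<le> 1/48" "\<bar>1 / t\<bar> = 1 / t" using t48 by simp_all
      then show ?thesis
        using cmod_le[of "Complex 1 (1 / t)"] unfolding complex.sel by linarith
    qed
    ultimately have "exp 1 * exp (2 * pi / (3 * t)) * cmod (Complex 1 (1 / t))
        \<le> (272/100) * (1 + 1/24 + (1/24)\<^sup>2) * (1 + 1/48)"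
      by (rule mult_mono) auto
    also have "\<dots> \<le> 3" by (simp add: power2_eq_square)
    finally show ?thesis by (simp add: exp_add)
  qed
  have arg: "exp (t * Im (Ln x)) \<le> exp 1"
    using Ln_shallow_line_le[of t u] t48 by (simp add: x_def)
  have gauss: "cmod x powr (- \<sigma>) * exp (- 2 * pi * Re x * Im x)
      \<le> M powr (- \<sigma>) * exp (2 * pi / (3 * t))"
    using gaussian_power_le[of "- \<sigma>" t u] \<sigma> t48 by (simp add: x_def M_def)
  have tail: "1 / D \<le> tail_majorant t u"
    using inverse_exp_diff_le_tail_majorant[of t u] t48 by (simp add: D_def x_def)
  have "cmod (aux_integrand (Complex \<sigma> t) x * Complex 1 (1 / t)) =
    exp (t * Im (Ln x)) * (cmod x powr (- \<sigma>) * exp (- 2 * pi * Re x * Im x))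
      * cmod (Complex 1 (1 / t)) * (1 / D)"
    using t48 shallow_line_ne_0[of t u] by (simp add: x_def D_def norm_mult cmod_aux_integrand)
  also have "\<dots> \<le> exp 1 * (M powr (- \<sigma>) * exp (2 * pi / (3 * t)))
      * cmod (Complex 1 (1 / t)) * tail_majorant t u"
    by (rule mult_mono[OF mult_mono[OF mult_mono[OF arg gauss] order_refl] tail])
      (auto simp: D_def)
  also have "\<dots> = (exp (1 + 2 * pi / (3 * t)) * cmod (Complex 1 (1 / t))) * (M powr (- \<sigma>) * tail_majorant t u)"
    by (simp add: exp_add)
  also have "\<dots> \<le> 3 * (M powr (- \<sigma>) * tail_majorant t u)"
    using const tm by (intro mult_right_mono) auto
  finally show ?thesis by (simp add: x_def)
qed

text \<open>Since \<open>1.7 \<le> sqrt pi\<close>, the main term has coefficient at most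
  \<open>12 / 1.7 < 19/2\<close> relative to \<open>t * sqrt t / pi\<close>; that quantity is at
  least 90, so the gap absorbs the remaining 3/2.\<close>

lemma tail_integral_numeric_bound:
  assumes t: "t \<ge> 16 * pi"
  shows "3 * (1/2 + 4 * (t / pi) powr (3/2)) \<le> 19 * t / (2 * pi) * sqrt t"
proof -
  have t48: "t \<ge> 48" using t pi_gt3 by linarith
  have "(t / pi) powr (3/2) = t / pi * sqrt (t / pi)"
    using t48 powr_add[of "t / pi" 1 "1/2"] by (simp add: powr_half_sqrt)
  also have "\<dots> \<le> t / pi * (sqrt t / 1.7)"
  proof (rule mult_left_mono)
    have "1.7 \<le> sqrt pi" by (rule real_le_rsqrt) (use pi_gt3 in \<open>simp add: power2_eq_square\<close>)
    then show "sqrt (t / pi) \<le> sqrt t / 1.7"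
      unfolding real_sqrt_divide using t48 by (intro divide_left_mono) auto
  qed (use t48 in auto)
  finally have 1: "(t / pi) powr (3/2) \<le> t * sqrt t / pi / 1.7" by simp
  have "48 * 6 \<le> t * sqrt t"
    using t48 by (intro mult_mono real_le_rsqrt) auto
  then have "90 \<le> t * sqrt t / pi"
    using pi_approx by (simp add: field_simps)
  then have "3 * (1/2 + 4 * (t * sqrt t / pi / 1.7)) \<le> 19/2 * (t * sqrt t / pi)"
    by simp
  with 1 show ?thesis by simp
qed

section \<open>Passage to the shallow line\<close>

lemma integrable_aux_integrand_shallow_line:
  assumes "\<sigma> \<le> 0" and t: "t \<ge> 16 * pi"
  shows "integrable lborel
    (\<lambda>u. aux_integrand (Complex \<sigma> t) (shallow_line t u) * Complex 1 (1 / t))"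
proof (rule Bochner_Integration.integrable_bound)
  define M where "M = sqrt ((1 - \<sigma>)\<^sup>2 + t\<^sup>2) / (2 * pi)"
  have "t > 0" using t pi_gt_zero by linarith
  show "integrable lborel (\<lambda>u. 3 * M powr (- \<sigma>) * tail_majorant t u)"
    using has_bochner_integral_tail_majorant[of t] by (simp add: has_bochner_integral_iff)
  have "isCont (\<lambda>u. aux_integrand (Complex \<sigma> t) (shallow_line t u)) u" for u
  proof (rule isCont_o2[where f = "shallow_line t" and g = "aux_integrand (Complex \<sigma> t)"])
    have "shallow_line t = (\<lambda>u. (1/2 + of_real u) + \<i> * (of_real u / of_real t))"
      by (auto simp: shallow_line_def complex_eq_iff Im_divide_of_real)
    moreover have "isCont \<dots> u"
      using \<open>t > 0\<close> by (intro continuous_intros) auto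
    ultimately show "isCont (shallow_line t) u" by simp
    show "isCont (aux_integrand (Complex \<sigma> t)) (shallow_line t u)"
      by (intro field_differentiable_imp_continuous_at aux_integrand_field_differentiable)
        (use \<open>t > 0\<close> in \<open>auto simp: shallow_line_def\<close>)
  qed
  then have "continuous_on UNIV (\<lambda>u. aux_integrand (Complex \<sigma> t) (shallow_line t u) * Complex 1 (1 / t))"
    by (intro continuous_intros) (simp add: continuous_at_imp_continuous_on)
  then show "(\<lambda>u. aux_integrand (Complex \<sigma> t) (shallow_line t u) * Complex 1 (1 / t))
      \<in> borel_measurable lborel"
    using borel_measurable_continuous_onI by simp
  show "AE u in lborel. norm (aux_integrand (Complex \<sigma> t) (shallow_line t u) * Complex 1 (1 / t))
      \<le> norm (3 * M powr (- \<sigma>) * tail_majorant t u)"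
  proof (rule AE_I2)
    fix u
    show "norm (aux_integrand (Complex \<sigma> t) (shallow_line t u) * Complex 1 (1 / t))
        \<le> norm (3 * M powr (- \<sigma>) * tail_majorant t u)"
      using cmod_aux_integrand_shallow_line_le[OF assms, of u]
      by (metis M_def abs_ge_self order_trans real_norm_def)
  qed
qed

text \<open>Integrability on both lines turns the limits of truncated integrals into Lebesgue
  integrals. On the shallow line it follows from the majorant; on the original line it is assumed
  here and settled later by a case distinction.\<close>

lemma riemann_aux_eq_shallow_line_integral:
  assumes c: "0 < c" "c < 1" and \<sigma>: "\<sigma> \<le> 0" and t: "t \<ge> 16 * pi"
    and int: "integrable lborel
      (\<lambda>u. aux_integrand (Complex \<sigma> t) (aux_line c u) * exp (\<i> * pi / 4))"
  shows "riemann_aux c (Complex \<sigma> t) =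
    - (LINT u|lborel. aux_integrand (Complex \<sigma> t) (shallow_line t u) * Complex 1 (1 / t))"
proof -
  let ?f = "aux_integrand (Complex \<sigma> t)"
  have t48: "t \<ge> 48" using t pi_gt3 by linarith
  define a where "a = exp (\<i> * pi / 4)"
  define b where "b = Complex 1 (1 / t)"
  have a: "Re a = sqrt 2 / 2" "Im a = sqrt 2 / 2"
    by (simp_all add: a_def Re_exp Im_exp cos_45 sin_45)
  \<comment> \<open>The original line is \<open>Re x - Im x = c\<close>, so the crossing point
    \<open>d\<close> has parameter \<open>u0\<close> with \<open>u0 - u0 / t = c - 1/2\<close> on
    the shallow line, and parameter \<open>v0\<close> on the original one.\<close>
  define u0 where "u0 = (c - 1/2) / (1 - 1 / t)"
  define v0 where "v0 = sqrt 2 * u0 / t"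
  define d where "d = shallow_line t u0"
  have "u0 * (1 - 1 / t) = c - 1/2" using t48 by (simp add: u0_def)
  then have u0: "u0 - u0 / t = c - 1/2" by (simp add: algebra_simps)
  have line_a: "aux_line c (v0 + u) = d + of_real u * a" for u
  proof -
    have "aux_line c (v0 + u) = of_real c + of_real (v0 + u) * a"
      by (simp add: aux_line_def a_def)
    also have "\<dots> = d + of_real u * a"
      using u0 by (simp add: complex_eq_iff a d_def shallow_line_def v0_def algebra_simps)
    finally show ?thesis .
  qed
  have line_b: "shallow_line t (u0 + u) = d + of_real u * b" for u
    by (simp add: complex_eq_iff b_def d_def shallow_line_def add_divide_distrib)
  have int_a: "integrable lborel (\<lambda>u. ?f (d + of_real u * a) * a)"
    using lborel_integrable_real_affine[OF int, of 1 v0] by (simp add: line_a flip: a_def)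
  have int_b: "integrable lborel (\<lambda>u. ?f (d + of_real u * b) * b)"
    using lborel_integrable_real_affine[OF integrable_aux_integrand_shallow_line[OF \<sigma> t], of 1 u0]
    by (simp add: line_b flip: b_def)
  have m: "0 < 1 / t" "1 / t \<le> sqrt 2 / 2" "1 / t \<le> 1"
  proof -
    have "1 \<le> sqrt 2" by simp
    moreover have "1 / t \<le> 1/2" using t48 by simp
    ultimately show "1 / t \<le> sqrt 2 / 2" "1 / t \<le> 1" by linarith+
    show "0 < 1 / t" using t48 by simp
  qed
  obtain B where B: "\<And>\<delta>. \<delta> \<in> {1, -1} \<Longrightarrow> \<forall>\<^sub>F R in at_top. \<forall>v\<in>{0..1}.
      cmod (?f (d + of_real R * ((1 - of_real v) * (\<delta> * a) + of_real v * (\<delta> * b)))) \<le> B R"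
    and lim: "((\<lambda>R. R * B R) \<longlongrightarrow> 0) at_top"
    using aux_integrand_decay[OF \<sigma>, of "1 / t" a b t d] m a by (auto simp: b_def)
  have fd: "?f field_differentiable at (d + of_real p * a + of_real q * b)"
    if pq: "p \<ge> 0 \<and> q \<ge> 0 \<or> p \<le> 0 \<and> q \<le> 0" for p q
  proof (rule aux_integrand_field_differentiable)
    let ?x = "d + of_real p * a + of_real q * b"
    assume Im: "Im ?x = 0"
    \<comment> \<open>Each left-hand side is constant on one of the two lines. At a real point of a
      cone the two identities force \<open>Re ?x\<close> to lie between \<open>c\<close> and 1/2,
      hence in (0,1).\<close>
    have l1: "Re ?x - Im ?x = c + q * (1 - 1 / t)"
      using u0 by (simp add: a b_def d_def shallow_line_def algebra_simps)
    have l2: "Im ?x - (Re ?x - 1/2) / t = p * (sqrt 2 / 2) * (1 - 1 / t)"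
      by (simp add: a b_def d_def shallow_line_def add_divide_distrib diff_divide_distrib algebra_simps)
    have "1 - 1 / t \<ge> 0" using m by simp
    from pq show "0 < Re ?x \<and> Re ?x < 1"
    proof (elim disjE conjE)
      assume "p \<ge> 0" "q \<ge> 0"
      then have "0 \<le> q * (1 - 1 / t)" "0 \<le> p * (sqrt 2 / 2) * (1 - 1 / t)"
        using \<open>1 - 1 / t \<ge> 0\<close> by auto
      then have "c \<le> Re ?x" "(Re ?x - 1/2) / t \<le> 0"
        using l1 l2 Im by linarith+
      then show ?thesis
        using c t48 by (simp add: divide_le_0_iff)
    next
      assume "p \<le> 0" "q \<le> 0"
      then have "q * (1 - 1 / t) \<le> 0" "p * (sqrt 2 / 2) * (1 - 1 / t) \<le> 0"
        using \<open>1 - 1 / t \<ge> 0\<close> by (auto intro!: mult_nonpos_nonneg)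
      then have "Re ?x \<le> c" "0 \<le> (Re ?x - 1/2) / t"
        using l1 l2 Im by linarith+
      then show ?thesis
        using c t48 by (simp add: zero_le_divide_iff)
    qed
  qed
  have "(LINT u|lborel. ?f (aux_line c u) * a) = (LINT u|lborel. ?f (d + of_real u * a) * a)"
    using lborel_integral_real_affine[of 1 "\<lambda>u. ?f (aux_line c u) * a" v0] by (simp add: line_a)
  also have "\<dots> = (LINT u|lborel. ?f (d + of_real u * b) * b)"
    by (rule crossing_lines_integral_eq[OF fd B lim int_a int_b])
  also have "\<dots> = (LINT u|lborel. ?f (shallow_line t u) * b)"
    using lborel_integral_real_affine[of 1 "\<lambda>u. ?f (shallow_line t u) * b" u0] by (auto simp: line_b)
  finally show ?thesis
    by (simp add: riemann_aux_def a_def b_def)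
qed

section \<open>Integration of the pointwise bound\<close>

theorem proposition13:
  fixes c \<sigma> t :: real
  assumes "0 < c" and "c < 1"
    and "\<sigma> \<le> 0" and "t \<ge> 16 * pi"
  shows "cmod (riemann_aux c (Complex \<sigma> t))
    \<le> 19 * t / (2 * pi) powr (1 - \<sigma>) * ((1 - \<sigma>)\<^sup>2 + t\<^sup>2) powr (1/4 - \<sigma>/2)"
proof -
  let ?F = "\<lambda>u. aux_integrand (Complex \<sigma> t) (aux_line c u) * exp (\<i> * pi / 4)"
  have "t > 0" using \<open>t \<ge> 16 * pi\<close> pi_gt_zero by linarith
  show ?thesis
  proof (cases "integrable lborel ?F")
    \<comment> \<open>Here the integral is zero by convention, so no estimate on the original line is needed.\<close>
    case False
    then have "riemann_aux c (Complex \<sigma> t) = 0"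
      unfolding riemann_aux_def by (subst not_integrable_integral_eq) auto
    then show ?thesis using \<open>t > 0\<close> by simp
  next
    case True
    define Q where "Q = (1 - \<sigma>)\<^sup>2 + t\<^sup>2"
    define M where "M = sqrt Q / (2 * pi)"
    have Q: "Q > 0" "t \<le> sqrt Q"
      using \<open>t > 0\<close> by (auto simp: Q_def add_nonneg_pos intro!: real_le_rsqrt)
    have "M > 0" using Q by (simp add: M_def)
    have "cmod (riemann_aux c (Complex \<sigma> t)) =
      cmod (LINT u|lborel. aux_integrand (Complex \<sigma> t) (shallow_line t u) * Complex 1 (1 / t))"
      using riemann_aux_eq_shallow_line_integral[OF assms True] by simp
    also have "\<dots> \<le> (LINT u|lborel. 3 * M powr (- \<sigma>) * tail_majorant t u)"
    proof (rule Bochner_Integration.integral_norm_bound_integral)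
      show "integrable lborel (\<lambda>u. 3 * M powr (- \<sigma>) * tail_majorant t u)"
        using has_bochner_integral_tail_majorant[of t] by (simp add: has_bochner_integral_iff)
    qed (use integrable_aux_integrand_shallow_line cmod_aux_integrand_shallow_line_le assms
          in \<open>auto simp: M_def Q_def\<close>)
    also have "\<dots> = M powr (- \<sigma>) * (3 * (1/2 + 4 * (t / pi) powr (3/2)))"
      using has_bochner_integral_tail_majorant[of t]
      by (simp add: has_bochner_integral_iff algebra_simps)
    also have "\<dots> \<le> M powr (- \<sigma>) * (19 * t / (2 * pi) * sqrt t)"
      by (rule mult_left_mono[OF tail_integral_numeric_bound]) (use assms in auto)
    \<comment> \<open>As \<open>t\<^sup>2 \<le> Q\<close>, replacing \<open>sqrt t\<close> supplies
      the exponent 1/4 of \<open>Q\<close>; the factor \<open>M powr (- \<sigma>)\<close> supplies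
      \<open>- \<sigma> / 2\<close> and the remaining power of \<open>2 * pi\<close>.\<close>
    also have "\<dots> \<le> M powr (- \<sigma>) * (19 * t / (2 * pi) * sqrt (sqrt Q))"
      using Q \<open>t > 0\<close> by (intro mult_left_mono) auto
    also have "\<dots> = 19 * t / (2 * pi) powr (1 - \<sigma>) * Q powr (1/4 - \<sigma>/2)"
    proof -
      have "M powr (- \<sigma>) = Q powr (- \<sigma> / 2) / (2 * pi) powr (- \<sigma>)"
        using Q by (simp add: M_def powr_divide powr_powr flip: powr_half_sqrt)
      moreover have "sqrt (sqrt Q) = Q powr (1/4)"
        using Q by (simp add: powr_powr flip: powr_half_sqrt)
      moreover have "Q powr (1/4 - \<sigma>/2) = Q powr (1/4) * Q powr (- \<sigma> / 2)"
        by (simp flip: powr_add)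
      moreover have "(2 * pi) powr (1 - \<sigma>) = 2 * pi * (2 * pi) powr (- \<sigma>)"
        using powr_add[of "2 * pi" 1 "- \<sigma>"] by simp
      ultimately show ?thesis by (simp add: mult_ac)
    qed
    finally show ?thesis by (simp add: Q_def)
  qed
qed

end
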